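(* Let $p$ be a prime and let $\Gamma$ be a lawless group generated by a finite set $S$ which is residually a finite $p$-group. Let $k\ge2$ be a fixed integer and let $\alpha = \log(2)/(\log(1+\sqrt{5})-\log(2))$. Then there exists $K\in\mathbb N$ such that for all $l\in\mathbb N$, $$\exp\big(\log(p)\, l^{1/\alpha}\big)\ \leq\ K\, \mathcal{F}_{\Gamma,p}^S\big( Kl\cdot \mathcal{A}_{\Gamma}^S (Kl) \big),$$ where $\mathcal A_\Gamma^S$ is the lawlessness growth function (defined using words in $F_k$) and $\mathcal F_{\Gamma,p}^S$ is the residual $p$-finiteness growth function of $\Gamma$.
   Context: $\mathbb{N}=\{1,2,\dots\}$. For a group $\Gamma$ with finite generating set $S$, $|g|_S$ denotes the word length of $g\in\Gamma$ with respect to $S$ (letters from $S\cup S^{-1}$). $F_k$ is the free group on $x_1,\dots,x_k$ and $|w|$ is the reduced length of $w\in F_k$. For $w\in F_k$ and $\mathbf g=(g_1,\dots,g_k)\in\Gamma^k$, $w(\mathbf g)$ is the image of $w$ under the homomorphism $F_k\to\Gamma$, $x_i\mapsto g_i$. A law for $\Gamma$ is a nontrivial $w$ in some $F_k$ with $w(\mathbf g)=1$ for all $\mathbf g\in\Gamma^k$; $\Gamma$ is lawless if it has no laws. For $\Gamma$ lawless and $1\neq w\in F_k$, the complexity is $\chi_\Gamma^S(w)=\min\{\sum_{i=1}^k|g_i|_S : \mathbf g\in\Gamma^k,\ w(\mathbf g)\neq 1\}$, and the lawlessness growth function is $\mathcal A_\Gamma^S(n)=\max\{\chi_\Gamma^S(w)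 : 1\neq w\in F_k,\ |w|\le n\}$, where the rank $k\ge 2$ is fixed. $\Gamma$ is residually a finite $p$-group if every $1\ne g\in\Gamma$ has nontrivial image under some surjective homomorphism from $\Gamma$ to a finite $p$-group; then $D_{\Gamma,p}(g)$ denotes the minimal order of such a finite $p$-group, and $\mathcal F_{\Gamma,p}^S(n)=\max\{D_{\Gamma,p}(g) : 1\neq g\in\Gamma,\ |g|_S\le n\}$. *)

theory Defs
  imports "HOL-Algebra.Algebra" Complex_Main
begin

section \<open>Free groups and word maps\<close>

text \<open>The letter \<open>(i, True)\<close> stands for the free generator \<open>x\<^sub>i\<^sub>+\<^sub>1\<close>, and \<open>(i, False)\<close> for its
  inverse. The elements of the free group of rank \<open>k\<close> are the reduced words in the letters with
  index below \<open>k\<close>, so the reduced length of an element is its list length.\<close>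

type_synonym letter = "nat \<times> bool"

definition letter_inv :: "letter \<Rightarrow> letter" where
  "letter_inv a = (fst a, \<not> snd a)"

definition reduced :: "letter list \<Rightarrow> bool" where
  "reduced w \<longleftrightarrow> successively (\<lambda>a b. b \<noteq> letter_inv a) w"

definition push :: "letter \<Rightarrow> letter list \<Rightarrow> letter list" where
  "push a w = (case w of [] \<Rightarrow> [a] | b # v \<Rightarrow> if b = letter_inv a then v else a # w)"

definition free_group :: "nat \<Rightarrow> letter list monoid" where
  "free_group k = \<lparr>carrier = {w. fst ` set w \<subseteq> {..<k} \<and> reduced w},
                   monoid.mult = (\<lambda>u v. foldr push u v),
                   one = []\<rparr>"

definition letter_val :: "('a, 'b) monoid_scheme \<Rightarrow> (nat \<Rightarrow> 'a) \<Rightarrow> letter \<Rightarrow> 'a" where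
  "letter_val G g a = (if snd a then g (fst a) else inv\<^bsub>G\<^esub> (g (fst a)))"

text \<open>The image of a word under \<open>x\<^sub>i \<mapsto> g\<^sub>i\<close>. The lemmas \<open>word_val_hom\<close>, \<open>word_val_generator\<close>
  and \<open>word_val_unique\<close> below show that it is the homomorphism determined by this assignment.\<close>

definition word_val :: "('a, 'b) monoid_scheme \<Rightarrow> (nat \<Rightarrow> 'a) \<Rightarrow> letter list \<Rightarrow> 'a" where
  "word_val G g w = foldr (\<lambda>a x. letter_val G g a \<otimes>\<^bsub>G\<^esub> x) w \<one>\<^bsub>G\<^esub>"

lemma letter_inv_inv [simp]: "letter_inv (letter_inv a) = a"
  by (simp add: letter_inv_def)

lemma letter_inv_neq [simp]: "letter_inv a \<noteq> a"
  by (cases a) (simp add: letter_inv_def)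

lemma fst_letter_inv [simp]: "fst (letter_inv a) = fst a"
  by (simp add: letter_inv_def)

lemma reduced_Nil [simp]: "reduced []"
  by (simp add: reduced_def)

lemma reduced_Cons: "reduced (a # w) \<longleftrightarrow> reduced w \<and> (w = [] \<or> hd w \<noteq> letter_inv a)"
  by (cases w) (auto simp: reduced_def)

lemma reduced_push: "reduced w \<Longrightarrow> reduced (push a w)"
  by (auto simp: push_def reduced_Cons split: list.splits)

lemma reduced_foldr_push: "reduced v \<Longrightarrow> reduced (foldr push u v)"
  by (induction u) (auto simp: reduced_push)

lemma set_push: "set (push a w) \<subseteq> insert a (set w)"
  by (auto simp: push_def split: list.splits)

lemma set_foldr_push: "set (foldr push u v) \<subseteq> set u \<union> set v"
proof (induction u)
  case (Cons a u)
  then show ?case using set_push[of a "foldr push u v"] by auto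
qed simp

lemma fst_set_foldr_push:
  assumes "fst ` set u \<subseteq> A" "fst ` set v \<subseteq> A"
  shows "fst ` set (foldr push u v) \<subseteq> A"
proof -
  have "fst ` set (foldr push u v) \<subseteq> fst ` (set u \<union> set v)"
    using set_foldr_push by (rule image_mono)
  also have "\<dots> \<subseteq> A"
    using assms by auto
  finally show ?thesis .
qed

lemma push_push_inv: "reduced w \<Longrightarrow> push a (push (letter_inv a) w) = w"
  by (auto simp: push_def reduced_Cons split: list.splits)

lemma foldr_push_push:
  assumes "reduced w"
  shows "foldr push (push a v) w = push a (foldr push v w)"
proof (cases v)
  case Nil
  then show ?thesis by (simp add: push_def[of a "[]"])
next
  case (Cons b v')
  then show ?thesis
    using push_push_inv[OF reduced_foldr_push[OF assms, of v'], of a]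
    by (simp add: push_def[of a "b # v'"])
qed

lemma foldr_push_assoc:
  assumes "reduced w"
  shows "foldr push (foldr push u v) w = foldr push u (foldr push v w)"
  by (induction u) (simp_all add: foldr_push_push assms)

lemma foldr_push_Nil: "reduced w \<Longrightarrow> foldr push w [] = w"
  by (induction w) (auto simp: reduced_Cons push_def split: list.splits)

lemma foldr_push_inverse:
  assumes "reduced w"
  shows "foldr push (rev (map letter_inv v)) (foldr push v w) = w"
  using assms
proof (induction v arbitrary: w)
  case (Cons a v)
  then show ?case
    using push_push_inv[of "foldr push v w" "letter_inv a"] by (simp add: reduced_foldr_push)
qed simp

lemma group_free_group: "group (free_group k)"
proof (rule groupI)
  fix w assume w: "w \<in> carrier (free_group k)"
  let ?v = "foldr push (rev (map letter_inv w)) []"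
  have "fst ` set (rev (map letter_inv w)) \<subseteq> {..<k}"
    using w by (auto simp: free_group_def)
  then have "fst ` set ?v \<subseteq> {..<k}"
    by (rule fst_set_foldr_push) simp
  then have "?v \<in> carrier (free_group k)"
    by (simp add: free_group_def reduced_foldr_push)
  moreover have "?v \<otimes>\<^bsub>free_group k\<^esub> w = \<one>\<^bsub>free_group k\<^esub>"
    using foldr_push_inverse[of "[]" w] foldr_push_assoc[of w "rev (map letter_inv w)" "[]"] w
    by (simp add: free_group_def foldr_push_Nil)
  ultimately show "\<exists>v \<in> carrier (free_group k). v \<otimes>\<^bsub>free_group k\<^esub> w = \<one>\<^bsub>free_group k\<^esub>"
    by blast
next
  fix u v assume "u \<in> carrier (free_group k)" "v \<in> carrier (free_group k)"
  then show "u \<otimes>\<^bsub>free_group k\<^esub> v \<in> carrier (free_group k)"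
    by (simp add: free_group_def reduced_foldr_push fst_set_foldr_push)
qed (auto simp: free_group_def foldr_push_assoc)

context group
begin

lemma letter_val_closed:
  "g \<in> {..<k} \<rightarrow> carrier G \<Longrightarrow> fst a < k \<Longrightarrow> letter_val G g a \<in> carrier G"
  by (auto simp: letter_val_def Pi_def)

lemma word_val_closed:
  "g \<in> {..<k} \<rightarrow> carrier G \<Longrightarrow> fst ` set w \<subseteq> {..<k} \<Longrightarrow> word_val G g w \<in> carrier G"
  by (induction w) (auto simp: word_val_def letter_val_closed)

lemma letter_val_inv:
  "g \<in> {..<k} \<rightarrow> carrier G \<Longrightarrow> fst a < k \<Longrightarrow> letter_val G g (letter_inv a) = inv (letter_val G g a)"
  by (auto simp: letter_val_def letter_inv_def Pi_def)

lemma word_val_push: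
  assumes g: "g \<in> {..<k} \<rightarrow> carrier G" and a: "fst a < k" and w: "fst ` set w \<subseteq> {..<k}"
  shows "word_val G g (push a w) = letter_val G g a \<otimes> word_val G g w"
proof (cases "w \<noteq> [] \<and> hd w = letter_inv a")
  case True
  then obtain v where v: "w = letter_inv a # v"
    by (cases w) auto
  have "letter_val G g a \<otimes> (inv (letter_val G g a) \<otimes> word_val G g v) = word_val G g v"
    using letter_val_closed[OF g a] word_val_closed[OF g, of v] w v
    by (simp add: m_assoc[symmetric])
  with v show ?thesis
    by (simp add: push_def word_val_def letter_val_inv[OF g a])
next
  case False
  then have "push a w = a # w"
    by (auto simp: push_def split: list.splits)
  then show ?thesis
    by (simp add: word_val_def)
qed

lemma word_val_foldr_push:
  assumes g: "g \<in> {..<k} \<rightarrow> carrier G" and "fst ` set u \<subseteq> {..<k}" and v: "fst ` set v \<subseteq> {..<k}"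
  shows "word_val G g (foldr push u v) = word_val G g u \<otimes> word_val G g v"
  using assms(2)
proof (induction u)
  case Nil
  then show ?case
    using word_val_closed[OF g v] by (simp add: word_val_def)
next
  case (Cons a u)
  then have a: "fst a < k" and u: "fst ` set u \<subseteq> {..<k}"
    by auto
  have "fst ` set (foldr push u v) \<subseteq> {..<k}"
    using u v by (rule fst_set_foldr_push)
  from word_val_push[OF g a this] Cons.IH[OF u]
  have "word_val G g (foldr push (a # u) v)
      = letter_val G g a \<otimes> (word_val G g u \<otimes> word_val G g v)"
    by simp
  also have "\<dots> = (letter_val G g a \<otimes> word_val G g u) \<otimes> word_val G g v"
    using letter_val_closed[OF g a] word_val_closed[OF g u] word_val_closed[OF g v]
    by (simp add: m_assoc)
  finally show ?case
    by (simp add: word_val_def)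
qed

lemma word_val_hom:
  "g \<in> {..<k} \<rightarrow> carrier G \<Longrightarrow> word_val G g \<in> hom (free_group k) G"
  by (rule homI) (auto simp: free_group_def word_val_closed word_val_foldr_push)

lemma word_val_generator:
  "g \<in> {..<k} \<rightarrow> carrier G \<Longrightarrow> i < k \<Longrightarrow> word_val G g [(i, True)] = g i"
  by (auto simp: word_val_def letter_val_def Pi_def)

lemma word_val_unique:
  assumes g: "g \<in> {..<k} \<rightarrow> carrier G" and h: "h \<in> hom (free_group k) G"
    and gen: "\<And>i. i < k \<Longrightarrow> h [(i, True)] = g i" and w: "w \<in> carrier (free_group k)"
  shows "h w = word_val G g w"
proof -
  interpret F: group "free_group k" by (rule group_free_group)
  interpret h: group_hom "free_group k" G h
    by unfold_locales (rule h)
  have pos: "[(i, True)] \<in> carrier (free_group k)" and neg: "[(i, False)] \<in> carrier (free_group k)"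
    if "i < k" for i
    using that by (auto simp: free_group_def reduced_def)
  have letter: "h [a] = letter_val G g a" if "fst a < k" for a
  proof (cases a)
    case (Pair i b)
    have "[(i, False)] = inv\<^bsub>free_group k\<^esub> [(i, True)]"
      using pos[of i] neg[of i] that Pair
      by (intro F.inv_equality[symmetric]) (auto simp: free_group_def push_def letter_inv_def)
    then show ?thesis
      using pos[of i] gen[of i] that Pair by (cases b) (auto simp: letter_val_def)
  qed
  from w show ?thesis
  proof (induction w)
    case Nil
    then show ?case
      using h.hom_one by (simp add: free_group_def word_val_def)
  next
    case (Cons a w)
    then have a: "fst a < k" and w: "w \<in> carrier (free_group k)"
      by (auto simp: free_group_def reduced_Cons)
    have "[a] \<in> carrier (free_group k)"
      using a by (auto simp: free_group_def reduced_def)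
    moreover have "a # w = [a] \<otimes>\<^bsub>free_group k\<^esub> w"
      using Cons.prems by (auto simp: free_group_def push_def reduced_Cons split: list.splits)
    ultimately have "h (a # w) = h [a] \<otimes> h w"
      using w by simp
    with Cons.IH[OF w] letter[OF a] show ?case
      by (simp add: word_val_def)
  qed
qed

end

section \<open>Lawlessness growth\<close>

definition is_law :: "('a, 'b) monoid_scheme \<Rightarrow> nat \<Rightarrow> letter list \<Rightarrow> bool" where
  "is_law G k w \<longleftrightarrow> w \<in> carrier (free_group k) \<and> w \<noteq> \<one>\<^bsub>free_group k\<^esub> \<and>
     (\<forall>g \<in> {..<k} \<rightarrow>\<^sub>E carrier G. word_val G g w = \<one>\<^bsub>G\<^esub>)"

definition lawless :: "('a, 'b) monoid_scheme \<Rightarrow> bool" where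
  "lawless G \<longleftrightarrow> (\<nexists>k w. is_law G k w)"

definition word_length :: "('a, 'b) monoid_scheme \<Rightarrow> 'a set \<Rightarrow> 'a \<Rightarrow> nat" where
  "word_length G S g = (LEAST n. \<exists>xs. length xs = n \<and> set xs \<subseteq> S \<union> (\<lambda>s. inv\<^bsub>G\<^esub> s) ` S \<and>
     foldr (\<lambda>x y. x \<otimes>\<^bsub>G\<^esub> y) xs \<one>\<^bsub>G\<^esub> = g)"

definition complexity :: "('a, 'b) monoid_scheme \<Rightarrow> 'a set \<Rightarrow> nat \<Rightarrow> letter list \<Rightarrow> nat" where
  "complexity G S k w =
     (LEAST n. \<exists>g \<in> {..<k} \<rightarrow>\<^sub>E carrier G. word_val G g w \<noteq> \<one>\<^bsub>G\<^esub> \<and>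
        n = (\<Sum>i<k. word_length G S (g i)))"

definition lawlessness_growth :: "('a, 'b) monoid_scheme \<Rightarrow> 'a set \<Rightarrow> nat \<Rightarrow> nat \<Rightarrow> nat" where
  "lawlessness_growth G S k n =
     Max {complexity G S k w | w.
       w \<in> carrier (free_group k) \<and> w \<noteq> \<one>\<^bsub>free_group k\<^esub> \<and> length w \<le> n}"

section \<open>Residual finiteness growth with respect to finite \<open>p\<close>-groups\<close>

definition finite_p_group :: "nat \<Rightarrow> ('a, 'b) monoid_scheme \<Rightarrow> bool" where
  "finite_p_group p Q \<longleftrightarrow> group Q \<and> finite (carrier Q) \<and> (\<exists>m. Coset.order Q = p ^ m)"

text \<open>The finite quotients range over groups whose carrier is a set of natural numbers. As every
  finite group is isomorphic to such a group, this loses no generality.\<close>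

definition detects :: "nat \<Rightarrow> ('a, 'b) monoid_scheme \<Rightarrow> 'a \<Rightarrow> nat monoid \<Rightarrow> bool" where
  "detects p G g Q \<longleftrightarrow> finite_p_group p Q \<and> (\<exists>\<phi> \<in> epi G Q. \<phi> g \<noteq> \<one>\<^bsub>Q\<^esub>)"

definition residually_finite_p :: "nat \<Rightarrow> ('a, 'b) monoid_scheme \<Rightarrow> bool" where
  "residually_finite_p p G \<longleftrightarrow> (\<forall>g \<in> carrier G. g \<noteq> \<one>\<^bsub>G\<^esub> \<longrightarrow> (\<exists>Q. detects p G g Q))"

definition detection_order :: "nat \<Rightarrow> ('a, 'b) monoid_scheme \<Rightarrow> 'a \<Rightarrow> nat" where
  "detection_order p G g = (LEAST n. \<exists>Q. detects p G g Q \<and> Coset.order Q = n)"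

definition residual_p_growth :: "nat \<Rightarrow> ('a, 'b) monoid_scheme \<Rightarrow> 'a set \<Rightarrow> nat \<Rightarrow> nat" where
  "residual_p_growth p G S n =
     Max {detection_order p G g | g. g \<in> carrier G \<and> g \<noteq> \<one>\<^bsub>G\<^esub> \<and> word_length G S g \<le> n}"

end

theory Submission
  imports Defs "HOL-Number_Theory.Fib"
begin

text \<open>Put \<open>c\<^sub>0 = x\<close>, \<open>c\<^sub>1 = y\<close> and \<open>c\<^sub>n\<^sub>+\<^sub>2 = [c\<^sub>n\<^sub>+\<^sub>1, c\<^sub>n\<inverse>]\<close> in the free group. The cancellation
  \<open>c\<^sub>n\<^sub>+\<^sub>3 = c\<^sub>n\<^sub>+\<^sub>2 c\<^sub>n\<^sub>+\<^sub>1\<inverse> d\<^sub>n\<close> with \<open>d\<^sub>n = c\<^sub>n\<inverse> c\<^sub>n\<^sub>+\<^sub>1 c\<^sub>n\<close> and \<open>d\<^sub>n\<^sub>+\<^sub>1 = d\<^sub>n\<inverse> c\<^sub>n\<^sub>+\<^sub>1\<close> makes the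
  length of \<open>c\<^sub>n\<close> grow only like \<open>2\<^sup>n\<close>, while its depth in the lower central series grows like the
  Fibonacci numbers. A value of \<open>c\<^sub>n\<^sub>+\<^sub>2\<close> that survives in a group of order \<open>p\<^sup>m\<close> therefore forces \<open>m\<close> to
  exceed the Fibonacci number with index \<open>n + 2\<close>. Lawlessness provides a nontrivial value of
  \<open>c\<^sub>n\<^sub>+\<^sub>2\<close> in \<open>\<Gamma>\<close> at short elements, and taking \<open>2\<^sup>n\<close> comparable to \<open>l\<close> gives the bound. That \<open>c\<^sub>n\<close>
  is nontrivial in the free group is seen in the symmetric group on five points, where for a
  suitable choice of \<open>x\<close> and \<open>y\<close> all \<open>c\<^sub>n\<close> are conjugate to a 5-cycle.\<close>

section \<open>Group words and the commutator sequence\<close>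

context group
begin

lemma inv_cancel:
  assumes "x \<in> carrier G" "y \<in> carrier G"
  shows "x \<otimes> (inv x \<otimes> y) = y" "inv x \<otimes> (x \<otimes> y) = y"
  using assms by (simp_all add: m_assoc[symmetric])

lemma conj_eq_one_iff:
  assumes "g \<in> carrier G" "x \<in> carrier G"
  shows "g \<otimes> x \<otimes> inv g = \<one> \<longleftrightarrow> x = \<one>"
proof
  assume "g \<otimes> x \<otimes> inv g = \<one>"
  then have "inv g \<otimes> (g \<otimes> x \<otimes> inv g) \<otimes> g = \<one>"
    using assms by simp
  then show "x = \<one>"
    using assms by (simp add: m_assoc inv_cancel)
qed (use assms in simp)

text \<open>Together with the simp rules for \<open>inv\<close> and the unit, these push inverses
  inward, associate to the right and cancel neighbours. They serve below to prove identities that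
  hold in every group.\<close>

lemmas word_simps = m_assoc inv_mult_group inv_cancel

end

fun comm_seq :: "('a, 'b) monoid_scheme \<Rightarrow> 'a \<Rightarrow> 'a \<Rightarrow> nat \<Rightarrow> 'a" where
  "comm_seq G x y 0 = x"
| "comm_seq G x y (Suc 0) = y"
| "comm_seq G x y (Suc (Suc n)) =
     comm_seq G x y (Suc n) \<otimes>\<^bsub>G\<^esub> inv\<^bsub>G\<^esub> (comm_seq G x y n)
       \<otimes>\<^bsub>G\<^esub> inv\<^bsub>G\<^esub> (comm_seq G x y (Suc n)) \<otimes>\<^bsub>G\<^esub> comm_seq G x y n"

lemma (in group) comm_seq_closed:
  assumes "x \<in> carrier G" "y \<in> carrier G"
  shows "comm_seq G x y n \<in> carrier G"
  by (induction n rule: induct_nat_012) (use assms in auto)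

lemma (in group_hom) hom_comm_seq:
  assumes "x \<in> carrier G" "y \<in> carrier G"
  shows "h (comm_seq G x y n) = comm_seq H (h x) (h y) n"
proof (induction n rule: induct_nat_012)
  case (ge2 n)
  then show ?case using assms by (simp add: G.comm_seq_closed)
qed auto

lemma (in group) length_comm_seq_le:
  fixes len :: "'a \<Rightarrow> nat"
  assumes mult: "\<And>u v. u \<in> carrier G \<Longrightarrow> v \<in> carrier G \<Longrightarrow> len (u \<otimes> v) \<le> len u + len v"
    and inv: "\<And>u. u \<in> carrier G \<Longrightarrow> len (inv u) \<le> len u"
    and x: "x \<in> carrier G" "len x \<le> 1" and y: "y \<in> carrier G" "len y \<le> 1"
  shows "len (comm_seq G x y n) \<le> 2 ^ Suc n"
proof -
  let ?c = "comm_seq G x y"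
  define d where "d n = inv (?c n) \<otimes> ?c (Suc n) \<otimes> ?c n" for n
  have c: "?c n \<in> carrier G" for n
    using x(1) y(1) by (rule comm_seq_closed)
  then have d: "d n \<in> carrier G" for n
    by (simp add: d_def)
  have d_Suc: "d (Suc n) = inv (d n) \<otimes> ?c (Suc n)" for n
    using c[of n] c[of "Suc n"] by (simp add: d_def word_simps)
  have c_Suc: "?c (Suc (Suc (Suc n))) = ?c (Suc (Suc n)) \<otimes> inv (?c (Suc n)) \<otimes> d n" for n
    using c[of n] c[of "Suc n"] by (simp add: d_def word_simps)
  have mult3: "len (u \<otimes> v \<otimes> w) \<le> len u + len v + len w"
    if "u \<in> carrier G" "v \<in> carrier G" "w \<in> carrier G" for u v w
    using mult[of "u \<otimes> v" w] mult[of u v] that by simp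
  \<comment> \<open>The conjugates \<open>d n\<close> are carried along because both cancelled
    recursions use them. The new terms are bounded by 2^(n+3) + 2^(n+2) + 2^(n+2) = 2^(n+4) and
    2^(n+2) + 2^(n+2) = 2^(n+3). Expanding the commutators without cancellation would only give
    L(n+2) \<le> 2 L(n+1) + 2 L(n), which is too weak.\<close>
  have "len (?c n) \<le> 2 ^ Suc n \<and> len (?c (Suc n)) \<le> 2 ^ Suc (Suc n) \<and>
      len (?c (Suc (Suc n))) \<le> 2 ^ Suc (Suc (Suc n)) \<and> len (d n) \<le> 2 ^ Suc (Suc n)" for n
  proof (induction n)
    case 0
    have "len (d 0) \<le> len (inv x) + len y + len x"
      using mult3[of "inv x" y x] x y by (simp add: d_def)
    moreover have "len (?c (Suc (Suc 0))) \<le> len y + len (inv x) + len (inv y) + len x"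
      using mult[of "y \<otimes> inv x \<otimes> inv y" x] mult3[of y "inv x" "inv y"] x y by simp
    ultimately show ?case
      using inv[of x] inv[of y] x y by simp
  next
    case (Suc n)
    have "len (d (Suc n)) \<le> len (d n) + len (?c (Suc n))"
      using mult[of "inv (d n)" "?c (Suc n)"] inv[of "d n"] c d unfolding d_Suc by fastforce
    moreover have "len (?c (Suc (Suc (Suc n)))) \<le> len (?c (Suc (Suc n))) + len (?c (Suc n)) + len (d n)"
      using mult3[of "?c (Suc (Suc n))" "inv (?c (Suc n))" "d n"] inv[of "?c (Suc n)"] c d
      unfolding c_Suc by fastforce
    ultimately show ?case
      using Suc.IH by (auto simp del: comm_seq.simps)
  qed
  then show ?thesis by blast
qed

text \<open>Under these hypotheses conjugation by \<open>g\<close> shifts the sequence by one step.\<close>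

lemma (in group) comm_seq_conj:
  assumes g: "g \<in> carrier G" and b: "b \<in> carrier G" and a: "a = g \<otimes> b \<otimes> inv g"
    and rel: "a \<otimes> inv b \<otimes> inv a \<otimes> b = g \<otimes> a \<otimes> inv g"
  shows "comm_seq G b a n = g [^] n \<otimes> b \<otimes> inv (g [^] n)"
proof (induction n rule: induct_nat_012)
  case (ge2 n)
  have a_closed: "a \<in> carrier G"
    using a b g by simp
  let ?h = "g [^] n"
  have h: "?h \<in> carrier G"
    using g by simp
  have pow: "g [^] Suc n = ?h \<otimes> g" "g [^] Suc (Suc n) = ?h \<otimes> g \<otimes> g"
    by simp_all
  have c: "comm_seq G b a (Suc n) = ?h \<otimes> a \<otimes> inv ?h"
    unfolding ge2(2) unfolding pow a using g b h by (simp add: word_simps)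
  \<comment> \<open>Both preceding terms are conjugates by \<open>?h\<close>, so \<open>?h\<close>
    can be pulled out of the commutator; \<open>rel\<close> then applies to what remains.\<close>
  have "comm_seq G b a (Suc (Suc n)) = ?h \<otimes> (a \<otimes> inv b \<otimes> inv a \<otimes> b) \<otimes> inv ?h"
    unfolding comm_seq.simps c ge2(1) using a_closed b h by (simp add: word_simps)
  also have "\<dots> = g [^] Suc (Suc n) \<otimes> b \<otimes> inv (g [^] Suc (Suc n))"
    unfolding rel pow unfolding a using g b h by (simp add: word_simps)
  finally show ?case .
qed (use g b a in auto)

text \<open>In a soluble group the sequence descends through the derived series and dies, so an
  insoluble group such as this one is required.\<close>

lemma sym_group_comm_seq_neq_one:
  obtains a b where "a \<in> carrier (sym_group 5)" "b \<in> carrier (sym_group 5)"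
    "\<And>n. comm_seq (sym_group 5) b a n \<noteq> \<one>\<^bsub>sym_group 5\<^esub>"
proof -
  interpret group "sym_group 5" by (rule sym_group_is_group)
  let ?t = "\<lambda>i j. transpose i j :: nat \<Rightarrow> nat"
  \<comment> \<open>\<open>b\<close> is the 5-cycle (1 2 3 4 5) and \<open>g\<close> the 3-cycle (1
    4 3); the primed permutations are their inverses. The choice of \<open>g\<close> is what makes
    the relation \<open>rel\<close> below hold, so that \<open>comm_seq_conj\<close>
    applies.\<close>
  define b where "b = ?t 1 2 \<circ> ?t 2 3 \<circ> ?t 3 4 \<circ> ?t 4 5"
  define b' where "b' = ?t 4 5 \<circ> ?t 3 4 \<circ> ?t 2 3 \<circ> ?t 1 2"
  define g where "g = ?t 1 4 \<circ> ?t 4 3"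
  define g' where "g' = ?t 4 3 \<circ> ?t 1 4"
  have closed: "b \<in> carrier (sym_group 5)" "b' \<in> carrier (sym_group 5)"
    "g \<in> carrier (sym_group 5)" "g' \<in> carrier (sym_group 5)"
    unfolding b_def b'_def g_def g'_def sym_group_carrier
    by (intro permutes_compose permutes_swap_id; simp)+
  have "b' \<circ> b = id" "g' \<circ> g = id"
    by (rule ext; simp add: b_def b'_def g_def g'_def)+
  then have inv: "inv\<^bsub>sym_group 5\<^esub> b = b'" "inv\<^bsub>sym_group 5\<^esub> g = g'"
    using closed by (intro inv_equality; simp only: sym_group_mult sym_group_one)+
  define a where "a = g \<otimes>\<^bsub>sym_group 5\<^esub> b \<otimes>\<^bsub>sym_group 5\<^esub> inv\<^bsub>sym_group 5\<^esub> g"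
  have a: "a \<in> carrier (sym_group 5)"
    unfolding a_def by (intro m_closed inv_closed closed)
  have a_eq: "a = g \<circ> b \<circ> g'"
    unfolding a_def inv sym_group_mult ..
  have "g \<circ> b' \<circ> g' \<circ> a = id"
    unfolding a_eq by (rule ext) (simp add: b_def b'_def g_def g'_def)
  moreover have "g \<circ> b' \<circ> g' \<in> carrier (sym_group 5)"
    unfolding sym_group_mult[symmetric, of 5] by (intro m_closed closed)
  ultimately have inv_a: "inv\<^bsub>sym_group 5\<^esub> a = g \<circ> b' \<circ> g'"
    using a by (intro inv_equality; simp only: sym_group_mult sym_group_one)
  have rel: "a \<otimes>\<^bsub>sym_group 5\<^esub> inv\<^bsub>sym_group 5\<^esub> b \<otimes>\<^bsub>sym_group 5\<^esub> inv\<^bsub>sym_group 5\<^esub> a \<otimes>\<^bsub>sym_group 5\<^esub> b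
      = g \<otimes>\<^bsub>sym_group 5\<^esub> a \<otimes>\<^bsub>sym_group 5\<^esub> inv\<^bsub>sym_group 5\<^esub> g"
    unfolding inv_a unfolding inv sym_group_mult a_eq
  proof (rule ext)
    fix x
    have table: "b 1 = 2" "b 2 = 3" "b 3 = 4" "b 4 = 5" "b 5 = 1"
      "b' 1 = 5" "b' 2 = 1" "b' 3 = 2" "b' 4 = 3" "b' 5 = 4"
      "g 1 = 4" "g 2 = 2" "g 3 = 1" "g 4 = 3" "g 5 = 5"
      "g' 1 = 3" "g' 2 = 2" "g' 3 = 4" "g' 4 = 1" "g' 5 = 5"
      by (simp_all add: b_def b'_def g_def g'_def)
    show "(g \<circ> b \<circ> g' \<circ> b' \<circ> (g \<circ> b' \<circ> g') \<circ> b) x = (g \<circ> (g \<circ> b \<circ> g') \<circ> g') x"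
    proof (cases "x \<in> {1..5}")
      case True
      then have "x = 1 \<or> x = 2 \<or> x = 3 \<or> x = 4 \<or> x = 5"
        by auto
      then show ?thesis
        by (elim disjE) (simp_all only: o_apply table)
    next
      case False
      then have "b x = x" "b' x = x" "g x = x" "g' x = x"
        using closed by (auto simp: sym_group_carrier intro: permutes_not_in)
      then show ?thesis
        by simp
    qed
  qed
  have "b 5 = 1"
    by (simp add: b_def)
  then have b_neq: "b \<noteq> \<one>\<^bsub>sym_group 5\<^esub>"
    by (auto simp: sym_group_one)
  have "comm_seq (sym_group 5) b a n \<noteq> \<one>\<^bsub>sym_group 5\<^esub>" for n
    using comm_seq_conj[OF closed(3,1) a_def rel, of n]
      conj_eq_one_iff[OF nat_pow_closed[OF closed(3)] closed(1)] b_neq by metis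
  with a closed(1) show ?thesis
    by (rule that)
qed

section \<open>Upper central series and commutator depth in finite p-groups\<close>

text \<open>This is the class equation. Without a nontrivial central element, every conjugacy class
  other than that of the unit has size a power of \<open>p\<close> different from 1, so
  \<open>p\<close> would divide p^m - 1.\<close>

lemma (in group) p_group_center:
  assumes p: "Factorial_Ring.prime p" and order: "Coset.order G = p ^ m" and m: "m > 0"
  shows "\<exists>z \<in> carrier G. z \<noteq> \<one> \<and> (\<forall>g \<in> carrier G. g \<otimes> z = z \<otimes> g)"
proof (rule ccontr)
  assume *: "\<not> ?thesis"
  define \<phi> where "\<phi> = (\<lambda>g. \<lambda>h \<in> carrier G. g \<otimes> h \<otimes> inv g)"
  interpret action: group_action G "carrier G" \<phi>
    unfolding \<phi>_def by (rule action_by_conjugation)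
  have "p ^ m > 0"
    using p by (simp add: prime_gt_0_nat)
  then have fin: "finite (carrier G)"
    using order unfolding Coset.order_def by (metis card.infinite less_numeral_extra(3))
  have one: "orbit G \<phi> \<one> = {\<one>}"
    unfolding orbit_def \<phi>_def by (auto intro: exI[of _ \<one>])
  have one_in: "{\<one>} \<in> orbits G (carrier G) \<phi>"
    unfolding orbits_def using one by blast
  have "p dvd card A" if A: "A \<in> orbits G (carrier G) \<phi> - {{\<one>}}" for A
  proof -
    from A obtain z where z: "z \<in> carrier G" "A = orbit G \<phi> z"
      unfolding orbits_def by blast
    have "z \<noteq> \<one>"
      using A z one by auto
    with * z obtain g where g: "g \<in> carrier G" "g \<otimes> z \<noteq> z \<otimes> g"
      by blast
    have "z \<in> A"
      using action.orbit_refl[OF z(1)] z(2) by simp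
    moreover have "g \<otimes> z \<otimes> inv g \<in> A"
      using g z unfolding orbit_def \<phi>_def by auto
    moreover have "g \<otimes> z \<otimes> inv g \<noteq> z"
      using g z inv_solve_right[of z "g \<otimes> z" g] by auto
    ultimately have "card A \<noteq> 1"
      by (auto simp: card_1_singleton_iff)
    moreover have "card A dvd p ^ m"
      using action.orbit_stabilizer_theorem[OF z(1)] order z(2) by (metis dvd_triv_left)
    ultimately show ?thesis
      using p by (metis divides_primepow_nat power_0 dvd_power gr0I)
  qed
  then have "p dvd (\<Sum>A \<in> orbits G (carrier G) \<phi> - {{\<one>}}. card A)"
    by (rule dvd_sum)
  moreover have "Coset.order G = (\<Sum>A \<in> orbits G (carrier G) \<phi>. card A)"
    using action.disjoint_sum[OF fin, of "\<lambda>_. 1::nat"] by (simp add: Coset.order_def)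
  moreover have "finite (orbits G (carrier G) \<phi>)"
    using fin by (simp add: orbits_def)
  ultimately have "p dvd p ^ m - 1"
    using one_in by (simp add: order sum.remove)
  moreover have "p dvd (p ^ m - 1) + 1"
    using m \<open>p ^ m > 0\<close> by simp
  ultimately have "p dvd 1"
    by (simp only: dvd_add_right_iff)
  with p show False
    by (simp add: prime_nat_iff)
qed

text \<open>The condition says that \<open>z\<close> is central modulo the preceding term. Stating
  it elementwise keeps quotient groups out of everything but
  \<open>upper_central_strict\<close>.\<close>

fun upper_central :: "('a, 'b) monoid_scheme \<Rightarrow> nat \<Rightarrow> 'a set" where
  "upper_central G 0 = {\<one>\<^bsub>G\<^esub>}"
| "upper_central G (Suc n) = {z \<in> carrier G. \<forall>g \<in> carrier G.
     g \<otimes>\<^bsub>G\<^esub> z \<otimes>\<^bsub>G\<^esub> inv\<^bsub>G\<^esub> g \<otimes>\<^bsub>G\<^esub> inv\<^bsub>G\<^esub> z \<in> upper_central G n}"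

text \<open>Expanding the commutator of \<open>g\<close> with a product, an inverse or a conjugate
  yields conjugates of commutators already known to lie in the preceding term; its normality, the
  induction hypothesis, absorbs these conjugations.\<close>

lemma (in group) upper_central_normal: "upper_central G n \<lhd> G"
proof (induction n)
  case 0
  show ?case
    using triv_subgroup by (auto simp: normal_inv_iff)
next
  case (Suc n)
  interpret N: normal "upper_central G n" G
    by (rule Suc.IH)
  let ?Z = "upper_central G (Suc n)"
  have "subgroup ?Z G"
  proof
    show "?Z \<subseteq> carrier G" "\<one> \<in> ?Z"
      by auto
  next
    fix z w assume z: "z \<in> ?Z" and w: "w \<in> ?Z"
    have "g \<otimes> (z \<otimes> w) \<otimes> inv g \<otimes> inv (z \<otimes> w) \<in> upper_central G n" if g: "g \<in> carrier G" for g
    proof -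
      have "g \<otimes> (z \<otimes> w) \<otimes> inv g \<otimes> inv (z \<otimes> w)
          = (g \<otimes> z \<otimes> inv g \<otimes> inv z) \<otimes> (z \<otimes> (g \<otimes> w \<otimes> inv g \<otimes> inv w) \<otimes> inv z)"
        using g z w by (simp add: word_simps)
      also have "\<dots> \<in> upper_central G n"
        by (rule N.m_closed[OF _ N.inv_op_closed2]) (use g z w in auto)
      finally show ?thesis .
    qed
    with z w show "z \<otimes> w \<in> ?Z"
      by simp
  next
    fix z assume z: "z \<in> ?Z"
    have "g \<otimes> inv z \<otimes> inv g \<otimes> inv (inv z) \<in> upper_central G n" if g: "g \<in> carrier G" for g
    proof -
      have "g \<otimes> inv z \<otimes> inv g \<otimes> inv (inv z) = inv (inv z \<otimes> (g \<otimes> z \<otimes> inv g \<otimes> inv z) \<otimes> z)"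
        using g z by (simp add: word_simps)
      also have "\<dots> \<in> upper_central G n"
        using g z by (intro N.m_inv_closed N.inv_op_closed1) auto
      finally show ?thesis .
    qed
    with z show "inv z \<in> ?Z"
      by simp
  qed
  moreover have "h \<otimes> z \<otimes> inv h \<in> ?Z" if h: "h \<in> carrier G" and z: "z \<in> ?Z" for h z
  proof -
    have "g \<otimes> (h \<otimes> z \<otimes> inv h) \<otimes> inv g \<otimes> inv (h \<otimes> z \<otimes> inv h) \<in> upper_central G n"
      if g: "g \<in> carrier G" for g
    proof -
      let ?g = "inv h \<otimes> g \<otimes> h"
      have "g \<otimes> (h \<otimes> z \<otimes> inv h) \<otimes> inv g \<otimes> inv (h \<otimes> z \<otimes> inv h)
          = h \<otimes> (?g \<otimes> z \<otimes> inv ?g \<otimes> inv z) \<otimes> inv h"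
        using g h z by (simp add: word_simps)
      also have "\<dots> \<in> upper_central G n"
      proof (rule N.inv_op_closed2[OF h])
        have "?g \<in> carrier G"
          using g h by simp
        then show "?g \<otimes> z \<otimes> inv ?g \<otimes> inv z \<in> upper_central G n"
          using z by simp
      qed
      finally show ?thesis .
    qed
    with h z show ?thesis
      by simp
  qed
  ultimately show ?case
    unfolding normal_inv_iff by blast
qed

lemma (in group) upper_central_Suc_mono: "upper_central G n \<subseteq> upper_central G (Suc n)"
proof
  fix z assume z: "z \<in> upper_central G n"
  interpret N: normal "upper_central G n" G
    by (rule upper_central_normal)
  show "z \<in> upper_central G (Suc n)"
    using z N.mem_carrier[OF z] by (auto intro!: N.inv_op_closed2)
qed

text \<open>The quotient by a proper term is a nontrivial p-group. A nontrivial central coset of it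
  lifts to an element of the next term outside the present one.\<close>

lemma (in group) upper_central_strict:
  assumes p: "Factorial_Ring.prime p" and order: "Coset.order G = p ^ m"
    and neq: "upper_central G n \<noteq> carrier G"
  shows "upper_central G n \<subset> upper_central G (Suc n)"
proof -
  let ?N = "upper_central G n"
  interpret N: normal ?N G
    by (rule upper_central_normal)
  interpret Q: group "G Mod ?N"
    by (rule N.factorgroup_is_group)
  have lagrange: "card (rcosets ?N) * card ?N = p ^ m"
    using lagrange[OF N.subgroup_axioms] order by simp
  then have "card (rcosets ?N) dvd p ^ m"
    by (metis dvd_triv_left)
  then obtain j where j: "card (rcosets ?N) = p ^ j"
    using p by (meson divides_primepow_nat)
  have "p ^ m > 0"
    using p by (simp add: prime_gt_0_nat)
  then have fin: "finite (carrier G)"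
    using order unfolding Coset.order_def by (metis card.infinite less_numeral_extra(3))
  have "j > 0"
  proof (rule ccontr)
    assume "\<not> j > 0"
    then have "card ?N = card (carrier G)"
      using lagrange j order by (simp add: Coset.order_def)
    with neq fin N.subset show False
      by (metis card_subset_eq)
  qed
  have "Coset.order (G Mod ?N) = p ^ j"
    using j by (simp add: Coset.order_def FactGroup_def)
  from Q.p_group_center[OF p this \<open>j > 0\<close>] obtain Z where Z: "Z \<in> carrier (G Mod ?N)"
    "Z \<noteq> \<one>\<^bsub>G Mod ?N\<^esub>" "\<And>C. C \<in> carrier (G Mod ?N) \<Longrightarrow> C \<otimes>\<^bsub>G Mod ?N\<^esub> Z = Z \<otimes>\<^bsub>G Mod ?N\<^esub> C"
    by blast
  from Z(1) obtain z where z: "z \<in> carrier G" "Z = ?N #> z"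
    by (auto simp: FactGroup_def RCOSETS_def)
  have "z \<notin> ?N"
    using Z(2) z by (auto simp: FactGroup_def N.rcos_const coset_join2 N.subgroup_axioms)
  moreover have "g \<otimes> z \<otimes> inv g \<otimes> inv z \<in> ?N" if g: "g \<in> carrier G" for g
  proof -
    have "?N #> g \<in> carrier (G Mod ?N)"
      using g by (auto simp: FactGroup_def RCOSETS_def)
    from Z(3)[OF this] have "?N #> (g \<otimes> z) = ?N #> (z \<otimes> g)"
      using g z by (simp add: N.rcos_sum FactGroup_def)
    then have "g \<otimes> z \<in> ?N #> (z \<otimes> g)"
      using rcos_self[OF _ N.subgroup_axioms] g z by (metis m_closed)
    then have "(g \<otimes> z) \<otimes> inv (z \<otimes> g) \<in> ?N"
      using g z by (meson N.rcos_module_imp m_closed is_group)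
    then show ?thesis
      using g z by (simp add: word_simps)
  qed
  ultimately show ?thesis
    using z upper_central_Suc_mono[of n] by auto
qed

text \<open>All terms have order a power of \<open>p\<close>, so each strict step multiplies the
  order by at least \<open>p\<close>, and \<open>m\<close> steps exhaust the group.\<close>

lemma (in group) upper_central_p_group:
  assumes p: "Factorial_Ring.prime p" and order: "Coset.order G = p ^ m"
  shows "upper_central G m = carrier G"
proof -
  have "p ^ m > 0"
    using p by (simp add: prime_gt_0_nat)
  then have fin: "finite (carrier G)"
    using order unfolding Coset.order_def by (metis card.infinite less_numeral_extra(3))
  have sub: "upper_central G n \<subseteq> carrier G" for n
    using upper_central_normal[of n] by (simp add: normal_imp_subgroup subgroup.subset)
  have exponent: "\<exists>e. card (upper_central G n) = p ^ e" for n
  proof -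
    have "card (upper_central G n) dvd p ^ m"
      using lagrange[OF normal_imp_subgroup[OF upper_central_normal[of n]]] order
      by (metis dvd_triv_right)
    then show ?thesis
      using p by (meson divides_primepow_nat)
  qed
  have "upper_central G n = carrier G \<or> p ^ n \<le> card (upper_central G n)" for n
  proof (induction n)
    case (Suc n)
    show ?case
    proof (cases "upper_central G n = carrier G")
      case True
      then show ?thesis
        using upper_central_Suc_mono[of n] sub[of "Suc n"] by blast
    next
      case False
      obtain d e where de: "card (upper_central G n) = p ^ d" "card (upper_central G (Suc n)) = p ^ e"
        using exponent by blast
      have "p ^ d < p ^ e"
        using psubset_card_mono[OF finite_subset[OF sub fin] upper_central_strict[OF p order False]] de
        by simp
      moreover have "p ^ n \<le> p ^ d"
        using False Suc.IH de by simp
      ultimately have "n < e"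
        using p by (meson le_less_trans power_less_imp_less_exp prime_gt_1_nat)
      then show ?thesis
        unfolding de(2) using p by (intro disjI2 power_increasing Suc_leI) (simp_all add: prime_ge_Suc_0_nat)
    qed
  qed simp
  from this[of m] show ?thesis
    using sub[of m] fin order by (metis Coset.order_def card_seteq)
qed

text \<open>The elements lowering the upper central series by \<open>i\<close> steps: a substitute for the
  \<open>i\<close>-th term of the lower central series, for which the commutator estimate
  \<open>central_shift_commutator\<close> needs no three subgroups lemma.\<close>

definition central_shift :: "('a, 'b) monoid_scheme \<Rightarrow> nat \<Rightarrow> 'a set" where
  "central_shift G i = {g \<in> carrier G. \<forall>j. \<forall>z \<in> upper_central G j.
     g \<otimes>\<^bsub>G\<^esub> z \<otimes>\<^bsub>G\<^esub> inv\<^bsub>G\<^esub> g \<otimes>\<^bsub>G\<^esub> inv\<^bsub>G\<^esub> z \<in> upper_central G (j - i)}"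

context group
begin

lemma upper_central_closed: "z \<in> upper_central G j \<Longrightarrow> z \<in> carrier G"
  using normal_imp_subgroup[OF upper_central_normal] subgroup.mem_carrier by metis

lemma upper_central_mult:
  "z \<in> upper_central G j \<Longrightarrow> w \<in> upper_central G j \<Longrightarrow> z \<otimes> w \<in> upper_central G j"
  using normal_imp_subgroup[OF upper_central_normal] subgroup.m_closed by metis

lemma upper_central_inv: "z \<in> upper_central G j \<Longrightarrow> inv z \<in> upper_central G j"
  using normal_imp_subgroup[OF upper_central_normal] subgroup.m_inv_closed by metis

lemma upper_central_conj:
  "g \<in> carrier G \<Longrightarrow> z \<in> upper_central G j \<Longrightarrow> g \<otimes> z \<otimes> inv g \<in> upper_central G j"
  using upper_central_normal normal.inv_op_closed2 by metis

lemma central_shift_closed: "g \<in> central_shift G i \<Longrightarrow> g \<in> carrier G"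
  by (simp add: central_shift_def)

lemma central_shiftD:
  "g \<in> central_shift G i \<Longrightarrow> z \<in> upper_central G j \<Longrightarrow>
    g \<otimes> z \<otimes> inv g \<otimes> inv z \<in> upper_central G (j - i)"
  by (simp add: central_shift_def)

text \<open>For positive \<open>j\<close> this is the recursion defining the series; for j = 0 the
  subtraction is truncated and the term is trivial.\<close>

lemma central_shift_one: "central_shift G (Suc 0) = carrier G"
proof -
  have "g \<otimes> z \<otimes> inv g \<otimes> inv z \<in> upper_central G (j - Suc 0)"
    if "g \<in> carrier G" "z \<in> upper_central G j" for g j z
    using that by (cases j) auto
  then show ?thesis
    by (auto simp: central_shift_def)
qed

text \<open>With the next two lemmas, this gives the normal subgroup properties that the commutator
  estimate relies on.\<close>

lemma central_shift_mult:
  assumes g: "g \<in> central_shift G i" and h: "h \<in> central_shift G i"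
  shows "g \<otimes> h \<in> central_shift G i"
proof -
  note closed = central_shift_closed[OF g] central_shift_closed[OF h]
  have "(g \<otimes> h) \<otimes> z \<otimes> inv (g \<otimes> h) \<otimes> inv z \<in> upper_central G (j - i)"
    if z: "z \<in> upper_central G j" for j z
  proof -
    have "(g \<otimes> h) \<otimes> z \<otimes> inv (g \<otimes> h) \<otimes> inv z
        = (g \<otimes> (h \<otimes> z \<otimes> inv h \<otimes> inv z) \<otimes> inv g) \<otimes> (g \<otimes> z \<otimes> inv g \<otimes> inv z)"
      using closed upper_central_closed[OF z] by (simp add: word_simps)
    also have "\<dots> \<in> upper_central G (j - i)"
      using g h z closed by (intro upper_central_mult upper_central_conj central_shiftD)
    finally show ?thesis .
  qed
  then show ?thesis
    using closed by (simp add: central_shift_def)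
qed

lemma central_shift_inv:
  assumes g: "g \<in> central_shift G i"
  shows "inv g \<in> central_shift G i"
proof -
  note closed = central_shift_closed[OF g]
  have "inv g \<otimes> z \<otimes> inv (inv g) \<otimes> inv z \<in> upper_central G (j - i)"
    if z: "z \<in> upper_central G j" for j z
  proof -
    have "inv g \<otimes> z \<otimes> inv (inv g) \<otimes> inv z
        = inv (inv g \<otimes> (g \<otimes> z \<otimes> inv g \<otimes> inv z) \<otimes> inv (inv g))"
      using closed upper_central_closed[OF z] by (simp add: word_simps)
    also have "\<dots> \<in> upper_central G (j - i)"
      using g z closed by (intro upper_central_inv upper_central_conj central_shiftD) auto
    finally show ?thesis .
  qed
  then show ?thesis
    using closed by (simp add: central_shift_def)
qed

lemma central_shift_conj:
  assumes g: "g \<in> central_shift G i" and h: "h \<in> carrier G"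
  shows "h \<otimes> g \<otimes> inv h \<in> central_shift G i"
proof -
  note closed = central_shift_closed[OF g] h
  have "h \<otimes> g \<otimes> inv h \<otimes> z \<otimes> inv (h \<otimes> g \<otimes> inv h) \<otimes> inv z \<in> upper_central G (j - i)"
    if z: "z \<in> upper_central G j" for j z
  proof -
    let ?z = "inv h \<otimes> z \<otimes> inv (inv h)"
    have "h \<otimes> g \<otimes> inv h \<otimes> z \<otimes> inv (h \<otimes> g \<otimes> inv h) \<otimes> inv z
        = h \<otimes> (g \<otimes> ?z \<otimes> inv g \<otimes> inv ?z) \<otimes> inv h"
      using closed upper_central_closed[OF z] by (simp add: word_simps)
    also have "\<dots> \<in> upper_central G (j - i)"
      using g z closed by (intro upper_central_conj central_shiftD) auto
    finally show ?thesis .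
  qed
  then show ?thesis
    using closed by (simp add: central_shift_def)
qed

text \<open>Since [g, h] is the quotient of gh by hg, it suffices to compare the conjugates of
  \<open>z\<close> by gh and by hg. With u = [h, z] and v = [g, z] these are [g, u] u v z and [h, v]
  v u z, so their quotient is [g, u] [u, v] [h, v]^(-1), and each factor drops by i + j.\<close>

lemma central_shift_commutator:
  assumes g: "g \<in> central_shift G i" and h: "h \<in> central_shift G j"
  shows "g \<otimes> h \<otimes> inv g \<otimes> inv h \<in> central_shift G (i + j)"
proof -
  note closed = central_shift_closed[OF g] central_shift_closed[OF h]
  let ?s = "g \<otimes> h" and ?t = "h \<otimes> g"
  have conj: "?s \<otimes> z \<otimes> inv ?s \<otimes> inv (?t \<otimes> z \<otimes> inv ?t) \<in> upper_central G (k - (i + j))"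
    if z: "z \<in> upper_central G k" for k z
  proof -
    note z_closed = upper_central_closed[OF z]
    let ?u = "h \<otimes> z \<otimes> inv h \<otimes> inv z" and ?v = "g \<otimes> z \<otimes> inv g \<otimes> inv z"
    have u: "?u \<in> upper_central G (k - j)" and v: "?v \<in> upper_central G (k - i)"
      using g h z by (simp_all add: central_shiftD)
    \<comment> \<open>For [u, v] the depth of \<open>?u\<close> as an acting element is needed: it
      is a product of \<open>h\<close> and a conjugate of \<open>inv h\<close>.\<close>
    have "?u = h \<otimes> (z \<otimes> inv h \<otimes> inv z)"
      using closed z_closed by (simp add: word_simps)
    then have u_shift: "?u \<in> central_shift G j"
      using h z_closed by (simp add: central_shift_mult central_shift_conj central_shift_inv)
    have "g \<otimes> ?u \<otimes> inv g \<otimes> inv ?u \<in> upper_central G (k - (i + j))"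
      using central_shiftD[OF g u] by (simp add: add.commute)
    moreover have "?u \<otimes> ?v \<otimes> inv ?u \<otimes> inv ?v \<in> upper_central G (k - (i + j))"
      using central_shiftD[OF u_shift v] by simp
    moreover have "h \<otimes> ?v \<otimes> inv h \<otimes> inv ?v \<in> upper_central G (k - (i + j))"
      using central_shiftD[OF h v] by simp
    ultimately have "(g \<otimes> ?u \<otimes> inv g \<otimes> inv ?u) \<otimes> (?u \<otimes> ?v \<otimes> inv ?u \<otimes> inv ?v)
        \<otimes> inv (h \<otimes> ?v \<otimes> inv h \<otimes> inv ?v) \<in> upper_central G (k - (i + j))"
      by (rule upper_central_mult[OF upper_central_mult upper_central_inv])
    moreover have "?s \<otimes> z \<otimes> inv ?s \<otimes> inv (?t \<otimes> z \<otimes> inv ?t)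
        = (g \<otimes> ?u \<otimes> inv g \<otimes> inv ?u) \<otimes> (?u \<otimes> ?v \<otimes> inv ?u \<otimes> inv ?v)
        \<otimes> inv (h \<otimes> ?v \<otimes> inv h \<otimes> inv ?v)"
      using closed z_closed by (simp add: word_simps)
    ultimately show ?thesis
      by simp
  qed
  have "(g \<otimes> h \<otimes> inv g \<otimes> inv h) \<otimes> z \<otimes> inv (g \<otimes> h \<otimes> inv g \<otimes> inv h) \<otimes> inv z
      \<in> upper_central G (k - (i + j))" if z: "z \<in> upper_central G k" for k z
  proof -
    \<comment> \<open>Applying \<open>conj\<close> to the conjugate of \<open>z\<close> by
      \<open>inv ?t\<close> turns the comparison into the statement about [g, h] and
      \<open>z\<close>.\<close>
    have "inv ?t \<otimes> z \<otimes> inv (inv ?t) \<in> upper_central G k"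
      using z closed by (intro upper_central_conj) auto
    from conj[OF this] show ?thesis
      using closed upper_central_closed[OF z] by (simp add: word_simps)
  qed
  then show ?thesis
    using closed by (simp add: central_shift_def)
qed

end

text \<open>Depths add under commutators, which is the Fibonacci recursion; the two initial terms
  have depth fib 1 = fib 2 = 1.\<close>

lemma (in group) comm_seq_shift:
  assumes x: "x \<in> carrier G" "y \<in> carrier G"
  shows "comm_seq G x y n \<in> central_shift G (fib (Suc n))"
proof (induction n rule: induct_nat_012)
  case (ge2 n)
  note closed = comm_seq_closed[OF x]
  show ?case
    using central_shift_commutator[OF ge2(2) central_shift_inv[OF ge2(1)]] closed[of n] by simp
qed (use x in \<open>simp_all add: central_shift_one\<close>)

lemma (in group) comm_seq_p_group_order:
  assumes p: "Factorial_Ring.prime p" and order: "Coset.order G = p ^ m"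
    and x: "x \<in> carrier G" "y \<in> carrier G" and neq: "comm_seq G x y (n + 2) \<noteq> \<one>"
  shows "fib (n + 2) < m"
proof (rule ccontr)
  assume "\<not> ?thesis"
  \<comment> \<open>The term with index n + 2 is the commutator of term n + 1, of depth
    \<open>fib (n + 2)\<close>, with an element of \<open>upper_central G m\<close>, the whole
    group. Truncated subtraction would place it in \<open>upper_central G 0\<close>, which is
    trivial.\<close>
  then have *: "m - fib (n + 2) = 0"
    by simp
  note closed = comm_seq_closed[OF x]
  have "inv (comm_seq G x y n) \<in> upper_central G m"
    using closed upper_central_p_group[OF p order] by simp
  from central_shiftD[OF comm_seq_shift[OF x, of "Suc n"] this] show False
    using neq closed * by simp
qed

text \<open>Both sides satisfy the Fibonacci recursion, and the index shift gives the initial values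
  fib 2 = 1 and fib 3 = 2, which dominate 1 and the golden ratio.\<close>

lemma golden_ratio_power_le_fib: "((1 + sqrt 5) / 2) ^ n \<le> real (fib (n + 2))"
proof (induction n rule: induct_nat_012)
  case 1
  have "sqrt 5 \<le> sqrt (3\<^sup>2)"
    by (intro real_sqrt_le_mono) simp
  then show ?case
    by (simp add: eval_nat_numeral)
next
  case (ge2 n)
  define \<phi> where "\<phi> = (1 + sqrt 5) / 2"
  have "\<phi> * \<phi> = \<phi> + 1"
    by (simp add: \<phi>_def field_simps)
  have "\<phi> ^ Suc (Suc n) = \<phi> ^ n * (\<phi> * \<phi>)"
    by simp
  also have "\<dots> = \<phi> ^ Suc n + \<phi> ^ n"
    unfolding \<open>\<phi> * \<phi> = \<phi> + 1\<close> by (simp add: algebra_simps)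
  finally show ?case
    using ge2 by (simp add: \<phi>_def)
qed auto

section \<open>Word length and the two growth functions\<close>

context group
begin

lemma foldr_mult_closed: "set xs \<subseteq> carrier G \<Longrightarrow> foldr (\<otimes>) xs \<one> \<in> carrier G"
  by (induction xs) auto

lemma foldr_mult_append:
  "set xs \<subseteq> carrier G \<Longrightarrow> set ys \<subseteq> carrier G \<Longrightarrow>
    foldr (\<otimes>) (xs @ ys) \<one> = foldr (\<otimes>) xs \<one> \<otimes> foldr (\<otimes>) ys \<one>"
  by (induction xs) (auto simp: m_assoc foldr_mult_closed simp del: foldr_append)

lemma foldr_mult_inv:
  "set xs \<subseteq> carrier G \<Longrightarrow> foldr (\<otimes>) (rev (map (\<lambda>x. inv x) xs)) \<one> = inv (foldr (\<otimes>) xs \<one>)"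
proof (induction xs)
  case (Cons x xs)
  moreover have "set (rev (map (\<lambda>x. inv x) xs)) \<subseteq> carrier G"
    using Cons.prems by auto
  ultimately show ?case
    using foldr_mult_append[of "rev (map (\<lambda>x. inv x) xs)" "[inv x]"]
    by (simp add: inv_mult_group foldr_mult_closed del: foldr_append)
qed simp

end

locale generated_group = group +
  fixes S
  assumes S_subset: "S \<subseteq> carrier G" and generate_S: "generate G S = carrier G"
begin

lemma letters_subset: "S \<union> (\<lambda>s. inv s) ` S \<subseteq> carrier G"
  using S_subset by auto

lemma word_length_le:
  "set xs \<subseteq> S \<union> (\<lambda>s. inv s) ` S \<Longrightarrow> foldr (\<otimes>) xs \<one> = g \<Longrightarrow> word_length G S g \<le> length xs"
  unfolding word_length_def by (rule Least_le) blast

text \<open>Generation by \<open>S\<close> ensures that a spelling exists, so the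
  \<open>LEAST\<close> in \<open>word_length\<close> is an attained minimum.\<close>

lemma word_length_attained:
  assumes "g \<in> carrier G"
  obtains xs where "length xs = word_length G S g" "set xs \<subseteq> S \<union> (\<lambda>s. inv s) ` S"
    "foldr (\<otimes>) xs \<one> = g"
proof -
  have "g \<in> generate G S"
    using assms generate_S by simp
  then have "\<exists>xs. set xs \<subseteq> S \<union> (\<lambda>s. inv s) ` S \<and> foldr (\<otimes>) xs \<one> = g"
  proof induction
    case one
    show ?case by (rule exI[of _ "[]"]) simp
  next
    case (incl h)
    then show ?case using S_subset by (intro exI[of _ "[h]"]) auto
  next
    case (inv h)
    then show ?case using S_subset by (intro exI[of _ "[inv h]"]) auto
  next
    case (eng h1 h2)
    then obtain xs ys where "set xs \<subseteq> S \<union> (\<lambda>s. inv s) ` S" "foldr (\<otimes>) xs \<one> = h1"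
      "set ys \<subseteq> S \<union> (\<lambda>s. inv s) ` S" "foldr (\<otimes>) ys \<one> = h2"
      by blast
    then show ?case
      using foldr_mult_append[of xs ys] subset_trans[OF _ letters_subset]
      by (intro exI[of _ "xs @ ys"]) (simp del: foldr_append)
  qed
  then have "\<exists>n xs. length xs = n \<and> set xs \<subseteq> S \<union> (\<lambda>s. inv s) ` S \<and> foldr (\<otimes>) xs \<one> = g"
    by blast
  from LeastI_ex[OF this] show ?thesis
    using that unfolding word_length_def by blast
qed

lemma word_length_one: "word_length G S \<one> = 0"
  using word_length_le[of "[]"] by simp

lemma word_length_mult:
  assumes "g \<in> carrier G" "h \<in> carrier G"
  shows "word_length G S (g \<otimes> h) \<le> word_length G S g + word_length G S h"
proof -
  obtain xs ys where xs: "length xs = word_length G S g" "set xs \<subseteq> S \<union> (\<lambda>s. inv s) ` S"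
    "foldr (\<otimes>) xs \<one> = g" and ys: "length ys = word_length G S h"
    "set ys \<subseteq> S \<union> (\<lambda>s. inv s) ` S" "foldr (\<otimes>) ys \<one> = h"
    using word_length_attained assms by metis
  then have "foldr (\<otimes>) (xs @ ys) \<one> = g \<otimes> h"
    using foldr_mult_append[of xs ys] subset_trans[OF _ letters_subset]
    by (simp del: foldr_append)
  then show ?thesis
    using word_length_le[of "xs @ ys"] xs ys by simp
qed

lemma word_length_inv:
  assumes "g \<in> carrier G"
  shows "word_length G S (inv g) \<le> word_length G S g"
proof -
  obtain xs where xs: "length xs = word_length G S g" "set xs \<subseteq> S \<union> (\<lambda>s. inv s) ` S"
    "foldr (\<otimes>) xs \<one> = g"
    using word_length_attained assms by metis
  then have "foldr (\<otimes>) (rev (map (\<lambda>x. inv x) xs)) \<one> = inv g"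
    using foldr_mult_inv[of xs] subset_trans[OF _ letters_subset] by blast
  moreover have "set (rev (map (\<lambda>x. inv x) xs)) \<subseteq> S \<union> (\<lambda>s. inv s) ` S"
    using xs(2) S_subset by fastforce
  ultimately show ?thesis
    using word_length_le[of "rev (map (\<lambda>x. inv x) xs)"] xs(1) by simp
qed

lemma finite_word_length_ball:
  assumes "finite S"
  shows "finite {g \<in> carrier G. word_length G S g \<le> n}"
proof (rule finite_subset)
  let ?L = "S \<union> (\<lambda>s. inv s) ` S"
  show "{g \<in> carrier G. word_length G S g \<le> n}
      \<subseteq> (\<lambda>xs. foldr (\<otimes>) xs \<one>) ` {xs. set xs \<subseteq> ?L \<and> length xs \<le> n}"
  proof clarify
    fix g assume g: "g \<in> carrier G" "word_length G S g \<le> n"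
    then show "g \<in> (\<lambda>xs. foldr (\<otimes>) xs \<one>) ` {xs. set xs \<subseteq> ?L \<and> length xs \<le> n}"
      by (metis (mono_tags, lifting) image_eqI mem_Collect_eq word_length_attained)
  qed
  show "finite ((\<lambda>xs. foldr (\<otimes>) xs \<one>) ` {xs. set xs \<subseteq> ?L \<and> length xs \<le> n})"
    using assms by (intro finite_imageI finite_lists_length_le) simp
qed

text \<open>Each letter is charged the total length of the tuple. This crude estimate produces the
  product of word length and lawlessness growth in the final bound.\<close>

lemma word_length_word_val:
  assumes g: "g \<in> {..<k} \<rightarrow> carrier G" and w: "fst ` set w \<subseteq> {..<k}"
  shows "word_length G S (word_val G g w) \<le> length w * (\<Sum>i<k. word_length G S (g i))"
  using w
proof (induction w)
  case Nil
  show ?case by (simp add: word_val_def word_length_one)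
next
  case (Cons a w)
  then have a: "fst a < k" and w: "fst ` set w \<subseteq> {..<k}"
    by auto
  have "g (fst a) \<in> carrier G"
    using g a by auto
  then have "word_length G S (letter_val G g a) \<le> word_length G S (g (fst a))"
    by (simp add: letter_val_def word_length_inv)
  also have "\<dots> \<le> (\<Sum>i<k. word_length G S (g i))"
    using a by (intro member_le_sum) auto
  finally have "word_length G S (letter_val G g a) \<le> (\<Sum>i<k. word_length G S (g i))" .
  moreover have "word_length G S (word_val G g (a # w))
      \<le> word_length G S (letter_val G g a) + word_length G S (word_val G g w)"
    using word_length_mult[OF letter_val_closed[OF g a] word_val_closed[OF g w]]
    by (simp add: word_val_def)
  ultimately show ?case
    using Cons.IH[OF w] by simp
qed

text \<open>Lawlessness makes the \<open>LEAST\<close> defining the complexity attained, and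
  finiteness of the balls in the free group makes the \<open>Max\<close> an upper bound.\<close>

lemma lawlessness_growth_witness:
  assumes lawless: "lawless G" and w: "w \<in> carrier (free_group k)" "w \<noteq> []" "length w \<le> n"
  obtains g where "g \<in> {..<k} \<rightarrow> carrier G" "word_val G g w \<noteq> \<one>"
    "(\<Sum>i<k. word_length G S (g i)) \<le> lawlessness_growth G S k n"
proof -
  have "\<not> is_law G k w"
    using lawless by (auto simp: lawless_def)
  then have "\<exists>m. \<exists>g \<in> {..<k} \<rightarrow>\<^sub>E carrier G. word_val G g w \<noteq> \<one> \<and>
      m = (\<Sum>i<k. word_length G S (g i))"
    using w by (auto simp: is_law_def free_group_def)
  from LeastI_ex[OF this] obtain g where g: "g \<in> {..<k} \<rightarrow>\<^sub>E carrier G" "word_val G g w \<noteq> \<one>"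
    "complexity G S k w = (\<Sum>i<k. word_length G S (g i))"
    unfolding complexity_def by blast
  let ?W = "{w \<in> carrier (free_group k). w \<noteq> \<one>\<^bsub>free_group k\<^esub> \<and> length w \<le> n}"
  have "?W \<subseteq> {w. set w \<subseteq> {..<k} \<times> UNIV \<and> length w \<le> n}"
    by (force simp: free_group_def)
  then have "finite ?W"
    by (rule finite_subset) (simp add: finite_lists_length_le)
  then have "finite (complexity G S k ` ?W)"
    by simp
  then have "complexity G S k w \<le> Max (complexity G S k ` ?W)"
    using w by (intro Max_ge) (auto simp: free_group_def)
  also have "complexity G S k ` ?W = {complexity G S k w | w.
      w \<in> carrier (free_group k) \<and> w \<noteq> \<one>\<^bsub>free_group k\<^esub> \<and> length w \<le> n}"
    by auto
  finally have "complexity G S k w \<le> lawlessness_growth G S k n"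
    by (simp add: lawlessness_growth_def)
  with g show ?thesis
    by (intro that[of g]) auto
qed

text \<open>Residual finiteness makes the \<open>LEAST\<close> attained; finiteness of
  \<open>S\<close> makes the balls finite, so that the \<open>Max\<close> is an upper bound.\<close>

lemma residual_p_growth_witness:
  assumes residual: "residually_finite_p p G" and S: "finite S"
    and g: "g \<in> carrier G" "g \<noteq> \<one>" "word_length G S g \<le> n"
  obtains Q where "detects p G g Q" "Coset.order Q \<le> residual_p_growth p G S n"
proof -
  have "\<exists>m Q. detects p G g Q \<and> Coset.order Q = m"
    using residual g by (auto simp: residually_finite_p_def)
  from LeastI_ex[OF this] obtain Q where Q: "detects p G g Q"
    "Coset.order Q = detection_order p G g"
    unfolding detection_order_def by blast
  let ?B = "{g \<in> carrier G. g \<noteq> \<one> \<and> word_length G S g \<le> n}"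
  have "finite ?B"
    by (rule finite_subset[OF _ finite_word_length_ball[OF S, of n]]) auto
  then have "finite (detection_order p G ` ?B)"
    by simp
  then have "detection_order p G g \<le> Max (detection_order p G ` ?B)"
    using g by (intro Max_ge) auto
  also have "detection_order p G ` ?B = {detection_order p G g | g.
      g \<in> carrier G \<and> g \<noteq> \<one> \<and> word_length G S g \<le> n}"
    by auto
  finally have "detection_order p G g \<le> residual_p_growth p G S n"
    by (simp add: residual_p_growth_def)
  with Q show ?thesis
    by (intro that[of Q]) auto
qed

end

section \<open>The commutator words in the free group\<close>

lemma length_push_le: "length (push a w) \<le> Suc (length w)"
  by (auto simp: push_def split: list.splits)

lemma length_foldr_push_le: "length (foldr push u v) \<le> length u + length v"
proof (induction u)
  case (Cons a u)
  then show ?case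
    using length_push_le[of a "foldr push u v"] by simp
qed simp

lemma length_free_group_inv_le:
  assumes "u \<in> carrier (free_group k)"
  shows "length (inv\<^bsub>free_group k\<^esub> u) \<le> length u"
proof -
  interpret F: group "free_group k" by (rule group_free_group)
  let ?v = "foldr push (rev (map letter_inv u)) []"
  have u: "fst ` set u \<subseteq> {..<k}" "reduced u"
    using assms by (auto simp: free_group_def)
  have "fst ` set ?v \<subseteq> {..<k}"
    using u by (intro fst_set_foldr_push) auto
  then have "?v \<in> carrier (free_group k)"
    by (simp add: free_group_def reduced_foldr_push)
  moreover have "?v \<otimes>\<^bsub>free_group k\<^esub> u = \<one>\<^bsub>free_group k\<^esub>"
    using foldr_push_inverse[of "[]" u] foldr_push_assoc[of u "rev (map letter_inv u)" "[]"] u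
    by (simp add: free_group_def foldr_push_Nil)
  ultimately have "inv\<^bsub>free_group k\<^esub> u = ?v"
    using assms by (metis F.inv_equality)
  then show ?thesis
    using length_foldr_push_le[of "rev (map letter_inv u)" "[]"] by simp
qed

definition comm_word :: "nat \<Rightarrow> nat \<Rightarrow> letter list" where
  "comm_word k n = comm_seq (free_group k) [(0, True)] [(1, True)] n"

context
  fixes k :: nat
  assumes k: "k \<ge> 2"
begin

lemma generators_closed:
  "[(0, True)] \<in> carrier (free_group k)" "[(1, True)] \<in> carrier (free_group k)"
  using k by (auto simp: free_group_def reduced_def)

lemma comm_word_closed: "comm_word k n \<in> carrier (free_group k)"
  unfolding comm_word_def by (rule group.comm_seq_closed[OF group_free_group generators_closed])

lemma length_comm_word_le: "length (comm_word k n) \<le> 2 ^ Suc n"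
  unfolding comm_word_def
proof (rule group.length_comm_seq_le[OF group_free_group])
  show "length (u \<otimes>\<^bsub>free_group k\<^esub> v) \<le> length u + length v" for u v
    by (simp add: free_group_def length_foldr_push_le)
qed (use generators_closed length_free_group_inv_le in auto)

lemma word_val_comm_word:
  assumes G: "group G" and g: "g \<in> {..<k} \<rightarrow> carrier G"
  shows "word_val G g (comm_word k n) = comm_seq G (g 0) (g 1) n"
proof -
  interpret group_hom "free_group k" G "word_val G g"
    using group.word_val_hom[OF G g]
    by (intro group_hom.intro group_hom_axioms.intro group_free_group G)
  show ?thesis
    using hom_comm_seq[OF generators_closed] group.word_val_generator[OF G g] k
    by (simp add: comm_word_def)
qed

lemma comm_word_neq_Nil: "comm_word k n \<noteq> []"
proof
  assume *: "comm_word k n = []"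
  obtain a b where ab: "a \<in> carrier (sym_group 5)" "b \<in> carrier (sym_group 5)"
    "comm_seq (sym_group 5) b a n \<noteq> \<one>\<^bsub>sym_group 5\<^esub>"
    using sym_group_comm_seq_neq_one by metis
  define g where "g i = (if i = 0 then b else a)" for i :: nat
  have "g \<in> {..<k} \<rightarrow> carrier (sym_group 5)"
    using ab by (auto simp: g_def)
  from word_val_comm_word[OF sym_group_is_group this, of n] ab(3) * show False
    by (simp add: g_def word_val_def)
qed

end

section \<open>Combining the length and depth estimates\<close>

theorem corollary8p5:
  fixes G :: "('a, 'b) monoid_scheme" and S :: "'a set" and p k :: nat and \<alpha> :: real
  assumes "Factorial_Ring.prime p"
    and "group G"
    and "finite S" and "S \<subseteq> carrier G" and "generate G S = carrier G"
    and "lawless G"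
    and "residually_finite_p p G"
    and "k \<ge> 2"
    and "\<alpha> = ln 2 / (ln (1 + sqrt 5) - ln 2)"
  shows "\<exists>K::nat. K \<ge> 1 \<and> (\<forall>l::nat. l \<ge> 1 \<longrightarrow>
    exp (ln (real p) * real l powr (1 / \<alpha>))
      \<le> real K * real (residual_p_growth p G S (K * l * lawlessness_growth G S k (K * l))))"
\<comment> \<open>The least \<open>n\<close> with l \<le> 2^n satisfies 2^n \<le> 2 l, and the word
  with index n + 2 has length at most 2^(n+3) = 8 * 2^n \<le> 16 l.\<close>
proof (intro exI[of _ 16] conjI allI impI)
  fix l :: nat assume l: "l \<ge> 1"
  interpret generated_group G S
    using assms by (intro generated_group.intro generated_group_axioms.intro)
  let ?\<phi> = "(1 + sqrt 5) / 2"
  let ?A = "lawlessness_growth G S k (16 * l)"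
  define n where "n = (LEAST n. l \<le> 2 ^ n)"
  have n: "l \<le> 2 ^ n"
    unfolding n_def by (rule LeastI[of _ l]) (simp add: less_imp_le)
  have "2 ^ n \<le> 2 * l"
  proof (cases n)
    case (Suc j)
    then have "\<not> l \<le> 2 ^ j"
      unfolding n_def by (intro not_less_Least) simp
    with Suc show ?thesis by simp
  qed (use l in simp)
  let ?w = "comm_word k (n + 2)"
  have "length ?w \<le> 16 * l"
    using length_comm_word_le[OF \<open>k \<ge> 2\<close>, of "n + 2"] \<open>2 ^ n \<le> 2 * l\<close> by simp
  from lawlessness_growth_witness[OF \<open>lawless G\<close> comm_word_closed comm_word_neq_Nil this]
  obtain g where g: "g \<in> {..<k} \<rightarrow> carrier G" "word_val G g ?w \<noteq> \<one>\<^bsub>G\<^esub>"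
    "(\<Sum>i<k. word_length G S (g i)) \<le> ?A"
    using \<open>k \<ge> 2\<close> by blast
  have w: "fst ` set ?w \<subseteq> {..<k}"
    using comm_word_closed[OF \<open>k \<ge> 2\<close>] by (auto simp: free_group_def)
  have "word_length G S (word_val G g ?w) \<le> length ?w * (\<Sum>i<k. word_length G S (g i))"
    by (rule word_length_word_val[OF g(1) w])
  also have "\<dots> \<le> 16 * l * ?A"
    using \<open>length ?w \<le> 16 * l\<close> g(3) by (rule mult_le_mono)
  finally obtain Q where Q: "detects p G (word_val G g ?w) Q"
    "Coset.order Q \<le> residual_p_growth p G S (16 * l * ?A)"
    using residual_p_growth_witness[OF \<open>residually_finite_p p G\<close> \<open>finite S\<close>
        word_val_closed[OF g(1) w] g(2)] by blast
  from Q(1) obtain m \<psi> where Q': "group Q" "Coset.order Q = p ^ m" "\<psi> \<in> hom G Q"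
    "\<psi> (word_val G g ?w) \<noteq> \<one>\<^bsub>Q\<^esub>"
    by (auto simp: detects_def finite_p_group_def epi_def)
  interpret \<psi>: group_hom G Q \<psi>
    using Q' by (intro group_hom.intro group_hom_axioms.intro) auto
  have g01: "g 0 \<in> carrier G" "g 1 \<in> carrier G"
    using g(1) \<open>k \<ge> 2\<close> by auto
  \<comment> \<open>The word value survives in \<open>Q\<close>, and its image there is again a term
    of the commutator sequence, so the order estimate for p-groups applies.\<close>
  have "comm_seq Q (\<psi> (g 0)) (\<psi> (g 1)) (n + 2) \<noteq> \<one>\<^bsub>Q\<^esub>"
    using Q'(4) word_val_comm_word[OF \<open>k \<ge> 2\<close> \<open>group G\<close> g(1)] \<psi>.hom_comm_seq[OF g01] by metis
  then have m: "fib (n + 2) < m"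
    by (rule group.comm_seq_p_group_order[OF Q'(1) \<open>Factorial_Ring.prime p\<close> Q'(2)
          \<psi>.hom_closed[OF g01(1)] \<psi>.hom_closed[OF g01(2)]])
  have p: "real p > 1"
    using prime_gt_1_nat[OF \<open>Factorial_Ring.prime p\<close>] by simp
  have "sqrt 5 > 1"
    by simp
  then have "ln 2 < ln (1 + sqrt 5)"
    by (subst ln_less_cancel_iff) linarith+
  then have "0 < 1 / \<alpha>"
    using assms by simp
  have "1 + sqrt 5 \<noteq> 0"
    using \<open>sqrt 5 > 1\<close> by linarith
  \<comment> \<open>The exponent is the base 2 logarithm of the golden ratio, so raising 2^n to it
    gives the n-th power of that ratio.\<close>
  then have \<alpha>: "1 / \<alpha> = ln ?\<phi> / ln 2"
    using assms by (simp add: ln_div)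
  have "real l \<le> real (2 ^ n)"
    using n by (rule of_nat_mono)
  then have "real l powr (1 / \<alpha>) \<le> (2 ^ n) powr (1 / \<alpha>)"
    using less_imp_le[OF \<open>0 < 1 / \<alpha>\<close>] by (intro powr_mono2) simp_all
  also have "\<dots> = ?\<phi> ^ n"
  proof -
    have "?\<phi> > 0"
      by (simp add: add_pos_nonneg)
    then have "?\<phi> ^ n = exp (real n * ln ?\<phi>)"
      by (simp add: exp_of_nat_mult)
    also have "\<dots> = (2 ^ n) powr (1 / \<alpha>)"
      by (simp add: powr_def \<alpha> ln_realpow)
    finally show ?thesis ..
  qed
  also have "\<dots> \<le> real m"
    using golden_ratio_power_le_fib[of n] m by linarith
  finally have "exp (ln (real p) * real l powr (1 / \<alpha>)) \<le> exp (ln (real p) * real m)"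
    using p by simp
  also have "\<dots> = real (Coset.order Q)"
    using p Q'(2) by (simp add: mult.commute exp_of_nat_mult)
  also have "\<dots> \<le> real (residual_p_growth p G S (16 * l * ?A))"
    using Q(2) by simp
  finally show "exp (ln (real p) * real l powr (1 / \<alpha>))
      \<le> real 16 * real (residual_p_growth p G S (16 * l * ?A))"
    by simp
qed simp

end
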